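(* Let $n\ge 1$, let $p\in[1,\infty]$, and assume $n\ge 2$ if $p=1$. Put $c_p=\frac{p}{p+n-2}$ if $p\in[1,\infty)$ and $c_\infty=1$. Let $\Omega\subset\mathbb{R}^n$ be a bounded open set with differentiable boundary $\partial\Omega$ and outer unit normal $\nu$, let $\bar x\in\Omega$, and define $R_1=\min_{x\in\partial\Omega}|x-\bar x|$ and $R_2=\max_{x\in\partial\Omega}|x-\bar x|$. Let $q:[R_1,R_2]\to\mathbb{R}$ be a function, and consider the overdetermined problem $$ (\ast)\qquad \begin{cases} -\Delta_p^N u=1 & \text{in }\Omega,\\ u=0,\quad -\dfrac{\partial u}{\partial\nu}=q(|x-\bar x|) & \text{on }\partial\Omega, \end{cases} $$ where solutions are understood in the viscosity sense. Then: 1. Suppose that the equation $q(r)-c_p\,r=0$ has a unique solution $R\in[R_1,R_2]$, and that $(q(r)-c_p\,r)(r-R)>0$ for all $r\in[R_1,R_2]\setminus\{R\}$. Then problem $(\ast)$ has a viscosity solution only in the special case when $R_1=R=R_2$ (i.e. $\Omega=B(\bar x,R)$). If, instead, $R_1<R_2$, then problem $(\ast)$ has no viscosity solution. 2. Suppose that the function $\rho(r)=\frac{q(r)}{r}$ is strictly increasing on $[R_1,R_2]$. Then problem $(\ast)$ has a viscosity solution only if $\Omega$ is a ball centered at $\bar x$. 3. If $q$ is continuous and the equation $q(r)-c_p\,r=0$ has no solution $r\in[R_1,R_2]$, then problem $(\ast)$ has no viscosity solution.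
   Context: $B(\bar x,R)$ is the open ball of center $\bar x$ and radius $R$. Normalized $p$-Laplacian. For $\varphi$ twice differentiable at $x_0$ with $D\varphi(x_0)\neq0$, set at $x_0$ $$\Delta_p^N\varphi=\tfrac1p|D\varphi|^{2-p}\,\mathrm{div}\big(|D\varphi|^{p-2}D\varphi\big)\ \ (1\le p<\infty),\qquad \Delta_\infty^N\varphi=|D\varphi|^{-2}\langle D^2\varphi\,D\varphi,D\varphi\rangle ,$$ where for finite $p$ the divergence is expanded in terms of $D\varphi(x_0)$ and $D^2\varphi(x_0)$, i.e. $\Delta_p^N\varphi=\frac1p\Delta\varphi+\frac{p-2}{p}|D\varphi|^{-2}\langle D^2\varphi\,D\varphi,D\varphi\rangle$; and define $\Delta_p^+\varphi(x_0)=\Delta_p^-\varphi(x_0)=\Delta_p^N\varphi(x_0)$. If $D\varphi(x_0)=0$, let $\lambda_1\le\dots\le\lambda_n$ be the eigenvalues of $D^2\varphi(x_0)$ and define $$\Delta_p^+\varphi(x_0)=\begin{cases}\frac{p-1}{p}\lambda_1+\frac1p\sum_{i=2}^n\lambda_i,&p\in[1,2],\\ \frac{p-1}{p}\lambda_n+\frac1p\sum_{i=1}^{n-1}\lambda_i,&p\in(2,\infty),\\ \lambda_n,&p=\infty,\end{cases}\qquad \Delta_p^-\varphi(x_0)=\begin{cases}\frac{p-1}{p}\lambda_n+\frac1p\sum_{i=1}^{n-1}\lambda_i,&p\in[1,2],\\ \frac{p-1}{p}\lambda_1+\frac1p\sum_{i=2}^{n}\lambda_i,&p\in(2,\infty),\\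 \lambda_1,&p=\infty.\end{cases}$$ Viscosity solution of $(\ast)$. For $x_0\in\overline\Omega$ write $u\prec_{x_0}\varphi$ (resp. $u\succ_{x_0}\varphi$) if $u-\varphi$ has a local maximum (resp. local minimum) at $x_0$, relative to the set $\overline\Omega$ on which $u$ is defined. A viscosity solution of $(\ast)$ is a function $u\in C(\overline\Omega)$ such that: (i) for every $x_0\in\Omega$ and every $\varphi\in C^2(\Omega)$: if $u\prec_{x_0}\varphi$ then $-\Delta_p^+\varphi(x_0)\le 1$, and if $u\succ_{x_0}\varphi$ then $-\Delta_p^-\varphi(x_0)\ge1$; (ii) $u=0$ on $\partial\Omega$; (iii) for every $x_0\in\partial\Omega$ and every $\varphi$ of class $C^2$ in a neighborhood of $x_0$: if $u\prec_{x_0}\varphi$ then $-\frac{\partial\varphi}{\partial\nu}(x_0)\ge q(|x_0-\bar x|)$, and if $u\succ_{x_0}\varphi$ then $-\frac{\partial\varphi}{\partial\nu}(x_0)\le q(|x_0-\bar x|)$. *)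

theory Defs
  imports "HOL-Analysis.Analysis" "HOL-Library.Multiset"
begin

definition grad :: "(real^'n \<Rightarrow> real) \<Rightarrow> real^'n \<Rightarrow> real^'n" where
  "grad \<phi> x = (\<chi> i. frechet_derivative \<phi> (at x) (axis i 1))"

definition hess :: "(real^'n \<Rightarrow> real) \<Rightarrow> real^'n \<Rightarrow> real^'n^'n" where
  "hess \<phi> x = jacobian (grad \<phi>) (at x)"

text \<open>Used for open \<open>S\<close> only; values of \<open>\<phi>\<close> outside \<open>S\<close> are irrelevant.\<close>

definition C2_on :: "(real^'n \<Rightarrow> real) \<Rightarrow> (real^'n) set \<Rightarrow> bool" where
  "C2_on \<phi> S \<longleftrightarrow>
     (\<forall>x\<in>S. \<phi> differentiable (at x)) \<and>
     (\<forall>x\<in>S. grad \<phi> differentiable (at x)) \<and>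
     continuous_on S (hess \<phi>)"

definition eigenspace :: "real^'n^'n \<Rightarrow> real \<Rightarrow> (real^'n) set" where
  "eigenspace A \<mu> = {v. A *v v = \<mu> *\<^sub>R v}"

text \<open>Eigenvalues in increasing order, each repeated according to the dimension of its eigenspace.
  For symmetric \<open>A\<close>, the only case of interest, the list has length \<open>CARD('n)\<close>.\<close>

definition eigenvalue_list :: "real^'n^'n \<Rightarrow> real list" where
  "eigenvalue_list A = sorted_list_of_multiset
     (\<Sum>\<mu> | eigenspace A \<mu> \<noteq> {0}. replicate_mset (dim (eigenspace A \<mu>)) \<mu>)"

text \<open>One-based: \<open>eigval A 1 \<le> \<dots> \<le> eigval A CARD('n)\<close>.\<close>

definition eigval :: "real^'n^'n \<Rightarrow> nat \<Rightarrow> real" where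
  "eigval A i = eigenvalue_list A ! (i - 1)"

text \<open>The exponent ranges over \<open>1 \<le> p \<le> \<infinity>\<close>. For finite \<open>p\<close> this is
  \<open>(1/p) |D\<phi>|^(2-p) div (|D\<phi>|^(p-2) D\<phi>)\<close> with the divergence expanded; meant for \<open>grad \<phi> x \<noteq> 0\<close>.\<close>

definition norm_laplacian :: "ereal \<Rightarrow> (real^'n \<Rightarrow> real) \<Rightarrow> real^'n \<Rightarrow> real" where
  "norm_laplacian p \<phi> x =
     (let D = grad \<phi> x; H = hess \<phi> x; r = real_of_ereal p in
      if p = \<infinity> then ((H *v D) \<bullet> D) / (norm D)\<^sup>2
      else trace H / r + (r - 2) / r * (((H *v D) \<bullet> D) / (norm D)\<^sup>2))"

definition upper_laplacian :: "ereal \<Rightarrow> (real^'n \<Rightarrow> real) \<Rightarrow> real^'n \<Rightarrow> real" where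
  "upper_laplacian p \<phi> x =
     (let ev = eigval (hess \<phi> x); n = CARD('n); r = real_of_ereal p in
      if grad \<phi> x \<noteq> 0 then norm_laplacian p \<phi> x
      else if p = \<infinity> then ev n
      else if p \<le> 2 then (r - 1) / r * ev 1 + 1 / r * (\<Sum>i=2..n. ev i)
      else (r - 1) / r * ev n + 1 / r * (\<Sum>i=1..n-1. ev i))"

definition lower_laplacian :: "ereal \<Rightarrow> (real^'n \<Rightarrow> real) \<Rightarrow> real^'n \<Rightarrow> real" where
  "lower_laplacian p \<phi> x =
     (let ev = eigval (hess \<phi> x); n = CARD('n); r = real_of_ereal p in
      if grad \<phi> x \<noteq> 0 then norm_laplacian p \<phi> x
      else if p = \<infinity> then ev 1
      else if p \<le> 2 then (r - 1) / r * ev n + 1 / r * (\<Sum>i=1..n-1. ev i)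
      else (r - 1) / r * ev 1 + 1 / r * (\<Sum>i=2..n. ev i))"

text \<open>Orthogonal projection onto the hyperplane normal to the unit vector \<open>e\<close>.\<close>

definition perp :: "real^'n \<Rightarrow> real^'n \<Rightarrow> real^'n" where
  "perp e x = x - (x \<bullet> e) *\<^sub>R e"

text \<open>Inside the open set \<open>U\<close>, \<open>\<Omega>\<close> is the part below the graph, in direction \<open>e\<close>, of a
  differentiable (not necessarily \<open>C\<^sup>1\<close>) function on that hyperplane. The function is represented
  by \<open>g\<close>, and only its values on the hyperplane matter.\<close>

definition graph_chart ::
  "(real^'n) set \<Rightarrow> (real^'n) set \<Rightarrow> real^'n \<Rightarrow> (real^'n \<Rightarrow> real) \<Rightarrow> bool" where
  "graph_chart \<Omega> U e g \<longleftrightarrow>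
     open U \<and> norm e = 1 \<and>
     (\<forall>x\<in>U. (\<lambda>y. g (perp e y)) differentiable (at x)) \<and>
     \<Omega> \<inter> U = {x\<in>U. x \<bullet> e < g (perp e x)}"

definition differentiable_boundary :: "(real^'n) set \<Rightarrow> bool" where
  "differentiable_boundary \<Omega> \<longleftrightarrow>
     (\<forall>x\<in>frontier \<Omega>. \<exists>U e g. x \<in> U \<and> graph_chart \<Omega> U e g)"

text \<open>The normalized gradient of \<open>y \<bullet> e - g (perp e y)\<close>, a function negative inside \<open>\<Omega>\<close> and
  positive outside. Its component along \<open>e\<close> is \<open>1\<close>, so it does not vanish, and its direction
  does not depend on the chart.\<close>

definition outer_unit_normal :: "(real^'n) set \<Rightarrow> real^'n \<Rightarrow> real^'n \<Rightarrow> bool" where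
  "outer_unit_normal \<Omega> x v \<longleftrightarrow>
     (\<exists>U e g. x \<in> U \<and> graph_chart \<Omega> U e g \<and>
        v = sgn (grad (\<lambda>y. y \<bullet> e - g (perp e y)) x))"

definition touches_above ::
  "(real^'n) set \<Rightarrow> (real^'n \<Rightarrow> real) \<Rightarrow> real^'n \<Rightarrow> (real^'n \<Rightarrow> real) \<Rightarrow> bool" where
  "touches_above \<Omega> u x0 \<phi> \<longleftrightarrow>
     (\<forall>\<^sub>F y in at x0 within closure \<Omega>. u y - \<phi> y \<le> u x0 - \<phi> x0)"

definition touches_below ::
  "(real^'n) set \<Rightarrow> (real^'n \<Rightarrow> real) \<Rightarrow> real^'n \<Rightarrow> (real^'n \<Rightarrow> real) \<Rightarrow> bool" where
  "touches_below \<Omega> u x0 \<phi> \<longleftrightarrow>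
     (\<forall>\<^sub>F y in at x0 within closure \<Omega>. u y - \<phi> y \<ge> u x0 - \<phi> x0)"

text \<open>Only the values of \<open>u\<close> on \<open>closure \<Omega>\<close> and of \<open>\<nu>\<close> on \<open>frontier \<Omega>\<close> matter.\<close>

definition viscosity_solution ::
  "ereal \<Rightarrow> (real^'n) set \<Rightarrow> (real^'n \<Rightarrow> real^'n) \<Rightarrow> real^'n \<Rightarrow> (real \<Rightarrow> real) \<Rightarrow>
   (real^'n \<Rightarrow> real) \<Rightarrow> bool" where
  "viscosity_solution p \<Omega> \<nu> xbar q u \<longleftrightarrow>
     continuous_on (closure \<Omega>) u \<and>
     (\<forall>x0\<in>\<Omega>. \<forall>\<phi>. C2_on \<phi> \<Omega> \<longrightarrow>
        (touches_above \<Omega> u x0 \<phi> \<longrightarrow> - upper_laplacian p \<phi> x0 \<le> 1) \<and>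
        (touches_below \<Omega> u x0 \<phi> \<longrightarrow> - lower_laplacian p \<phi> x0 \<ge> 1)) \<and>
     (\<forall>x0\<in>frontier \<Omega>. u x0 = 0) \<and>
     (\<forall>x0\<in>frontier \<Omega>. \<forall>\<phi>. (\<exists>U. open U \<and> x0 \<in> U \<and> C2_on \<phi> U) \<longrightarrow>
        (touches_above \<Omega> u x0 \<phi> \<longrightarrow>
           - frechet_derivative \<phi> (at x0) (\<nu> x0) \<ge> q (norm (x0 - xbar))) \<and>
        (touches_below \<Omega> u x0 \<phi> \<longrightarrow>
           - frechet_derivative \<phi> (at x0) (\<nu> x0) \<le> q (norm (x0 - xbar))))"

definition c_const :: "ereal \<Rightarrow> nat \<Rightarrow> real" where
  "c_const p n = (if p = \<infinity> then 1 else real_of_ereal p / (real_of_ereal p + real n - 2))"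

end

theory Submission
  imports Defs
begin

text \<open>
  The paraboloid \<open>b - a/2 |x - xbar|\<^sup>2\<close> has \<open>-\<Delta>\<^sub>p\<^sup>N = a/c\<close> everywhere, also at its vertex, so it is a
  strict sub- or supersolution for \<open>a < c\<close> or \<open>a > c\<close> and can be used directly as a test
  function. Comparing it with \<open>u\<close> and letting \<open>a\<close> tend to \<open>c\<close> places \<open>u\<close> between the paraboloids
  with \<open>a = c\<close> vanishing on the spheres of radius \<open>R1\<close> and \<open>R2\<close>. These touch \<open>u\<close> at the boundary
  points nearest to and farthest from \<open>xbar\<close>, and the Neumann condition there yields
  \<open>c R1 \<le> q R1\<close> and \<open>q R2 \<le> c R2\<close>.
\<close>

section \<open>Derivatives and normalized Laplacian of paraboloids\<close>

definition paraboloid :: "real \<Rightarrow> real \<Rightarrow> real^'n \<Rightarrow> real^'n \<Rightarrow> real" where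
  "paraboloid a b z x = b - a / 2 * (norm (x - z))\<^sup>2"

lemma paraboloid_has_derivative:
  "(paraboloid a b z has_derivative (\<lambda>h. - a * ((x - z) \<bullet> h))) (at x)"
proof -
  have "((\<lambda>x. b - a / 2 * ((x - z) \<bullet> (x - z))) has_derivative (\<lambda>h. - a * ((x - z) \<bullet> h))) (at x)"
    by (auto intro!: derivative_eq_intros simp: inner_commute algebra_simps)
  then show ?thesis
    by (simp add: paraboloid_def[abs_def] power2_norm_eq_inner)
qed

lemma frechet_derivative_paraboloid:
  "frechet_derivative (paraboloid a b z) (at x) = (\<lambda>h. - a * ((x - z) \<bullet> h))"
  using frechet_derivative_at[OF paraboloid_has_derivative] by metis

lemma grad_paraboloid: "grad (paraboloid a b z) = (\<lambda>x. (- a) *\<^sub>R (x - z))"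
  by (auto simp: fun_eq_iff vec_eq_iff grad_def frechet_derivative_paraboloid inner_axis)

lemma grad_paraboloid_has_derivative:
  "(grad (paraboloid a b z) has_derivative (\<lambda>h. (- a) *\<^sub>R h)) (at x)"
  unfolding grad_paraboloid by (auto intro!: derivative_eq_intros)

lemma hess_paraboloid: "hess (paraboloid a b z) x = mat (- a)"
  unfolding hess_def jacobian_def
    frechet_derivative_at[OF grad_paraboloid_has_derivative, symmetric]
  by (auto simp: matrix_def mat_def axis_def vec_eq_iff)

lemma C2_on_paraboloid: "C2_on (paraboloid a b z) S"
  unfolding C2_on_def hess_paraboloid[abs_def]
  by (blast intro: differentiableI paraboloid_has_derivative grad_paraboloid_has_derivative
      continuous_on_const)

lemma continuous_on_paraboloid: "continuous_on S (paraboloid a b z)"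
  unfolding paraboloid_def[abs_def] by (intro continuous_intros)

lemma mat_mult_vec: "mat a *v v = a *\<^sub>R (v :: real^'n)"
  by (simp add: vec_eq_iff matrix_vector_mult_def mat_def if_distrib[of "\<lambda>x. x * _"] cong: if_cong)

lemma trace_mat: "trace (mat a :: real^'n^'n) = real CARD('n) * a"
  by (simp add: trace_def mat_def)

lemma eigenspace_mat: "eigenspace (mat a :: real^'n^'n) \<mu> = (if \<mu> = a then UNIV else {0})"
  by (auto simp: eigenspace_def mat_mult_vec)

text \<open>Only \<open>a\<close> has a nontrivial eigenspace, and that eigenspace is the whole
  space, so the sum of multisets collapses to \<open>a\<close> with multiplicity
  \<open>CARD('n)\<close>.\<close>

lemma eigenvalue_list_mat: "eigenvalue_list (mat a :: real^'n^'n) = replicate CARD('n) a"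
proof -
  have "(UNIV :: (real^'n) set) \<noteq> {0}"
    using UNIV_not_singleton by blast
  then have "{\<mu>. eigenspace (mat a :: real^'n^'n) \<mu> \<noteq> {0}} = {a}"
    by (auto simp: eigenspace_mat)
  then have "eigenvalue_list (mat a :: real^'n^'n)
      = sorted_list_of_multiset (mset (replicate CARD('n) a))"
    by (simp add: eigenvalue_list_def eigenspace_mat)
  then show ?thesis
    by (simp only: sorted_list_of_multiset_mset sorted_sort_id sorted_replicate)
qed

lemma eigval_mat:
  assumes "1 \<le> i" "i \<le> CARD('n)"
  shows "eigval (mat a :: real^'n^'n) i = a"
  using assms by (simp add: eigval_def eigenvalue_list_mat)

text \<open>For finite p the denominator p + n - 2 is positive as soon as p > 1 or n > 1; the
  remaining case p = n = 1 is ruled out by the second assumption.\<close>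

lemma c_const_pos:
  assumes "1 \<le> p" "p = 1 \<Longrightarrow> CARD('n) \<ge> 2"
  shows "0 < c_const p CARD('n::finite)"
proof (cases p)
  case (real r)
  then have "r \<ge> 1" and "r = 1 \<Longrightarrow> CARD('n) \<ge> 2"
    using assms by auto
  moreover have "CARD('n) \<ge> 1"
    by (simp add: Suc_leI)
  ultimately have "r + real CARD('n) - 2 > 0"
    by (cases "r = 1") linarith+
  with real \<open>r \<ge> 1\<close> show ?thesis by (simp add: c_const_def)
qed (use assms in \<open>auto simp: c_const_def\<close>)

text \<open>The Hessian is \<open>- a\<close> times the identity, so every weighted mean of
  eigenvalues in the definitions sees the same number. For finite p the weights add up to (p + n -
  2) / p = 1 / c, whether or not the gradient vanishes, and the upper and lower operators
  agree.\<close>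

lemma laplacian_paraboloid:
  fixes z x :: "real^'n"
  assumes p: "1 \<le> p" "p = 1 \<Longrightarrow> CARD('n) \<ge> 2"
  shows "- upper_laplacian p (paraboloid a b z) x = a / c_const p CARD('n)"
    and "- lower_laplacian p (paraboloid a b z) x = a / c_const p CARD('n)"
proof -
  let ?n = "CARD('n)"
  let ?r = "real_of_ereal p"
  let ?A = "mat (- a) :: real^'n^'n"
  let ?D = "grad (paraboloid a b z) x"
  have n: "?n \<ge> 1" by (simp add: Suc_leI)
  have ev: "eigval ?A 1 = - a" "eigval ?A ?n = - a"
    using n by (simp_all add: eigval_mat)
  have "(\<Sum>i=2..?n. eigval ?A i) = (\<Sum>i=2..?n. - a)"
    "(\<Sum>i=1..?n-1. eigval ?A i) = (\<Sum>i=1..?n-1. - a)"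
    by (intro sum.cong eigval_mat; auto)+
  then have sums: "(\<Sum>i=2..?n. eigval ?A i) = (real ?n - 1) * (- a)"
    "(\<Sum>i=1..?n-1. eigval ?A i) = (real ?n - 1) * (- a)"
    using n by (simp_all add: of_nat_diff algebra_simps)
  have r: "?r \<ge> 1" if "p \<noteq> \<infinity>"
    using that p by (cases p) auto
  have inf: "- a = - a / c_const p ?n" if "p = \<infinity>"
    using that by (simp add: c_const_def)
  \<comment> \<open>With all eigenvalues equal, the branches for \<open>p \<le> 2\<close> and for
    finite \<open>p > 2\<close> reduce to this one expression.\<close>
  have deg: "(?r - 1) / ?r * - a + 1 / ?r * ((real ?n - 1) * - a) = - a / c_const p ?n"
    if "p \<noteq> \<infinity>"
    using that r by (simp add: c_const_def field_simps)
  have nl: "norm_laplacian p (paraboloid a b z) x = - a / c_const p ?n" if "?D \<noteq> 0"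
  proof -
    have quot: "((?A *v ?D) \<bullet> ?D) / (norm ?D)\<^sup>2 = - a"
      using that by (simp add: mat_mult_vec power2_norm_eq_inner)
    have "real ?n * - a / ?r + (?r - 2) / ?r * - a = - a / c_const p ?n" if "p \<noteq> \<infinity>"
      using that r by (simp add: c_const_def field_simps)
    then show ?thesis
      unfolding norm_laplacian_def Let_def hess_paraboloid quot trace_mat using inf by metis
  qed
  have "upper_laplacian p (paraboloid a b z) x = - a / c_const p ?n"
    unfolding upper_laplacian_def Let_def hess_paraboloid ev sums using nl deg inf by metis
  then show "- upper_laplacian p (paraboloid a b z) x = a / c_const p ?n" by simp
  have "lower_laplacian p (paraboloid a b z) x = - a / c_const p ?n"
    unfolding lower_laplacian_def Let_def hess_paraboloid ev sums using nl deg inf by metis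
  then show "- lower_laplacian p (paraboloid a b z) x = a / c_const p ?n" by simp
qed

section \<open>Comparison of a solution with paraboloids\<close>

lemma viscosity_solution_interior:
  assumes "viscosity_solution p \<Omega> \<nu> z q u" "x \<in> \<Omega>" "C2_on \<phi> \<Omega>"
  shows "touches_above \<Omega> u x \<phi> \<Longrightarrow> - upper_laplacian p \<phi> x \<le> 1"
    and "touches_below \<Omega> u x \<phi> \<Longrightarrow> - lower_laplacian p \<phi> x \<ge> 1"
  using assms(1)[unfolded viscosity_solution_def, THEN conjunct2, THEN conjunct1] assms(2,3)
  by blast+

context
  fixes p :: ereal and \<Omega> :: "(real^'n) set" and \<nu> :: "real^'n \<Rightarrow> real^'n"
    and z :: "real^'n" and q :: "real \<Rightarrow> real" and u :: "real^'n \<Rightarrow> real" and c :: real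
  assumes p: "1 \<le> p" "p = 1 \<Longrightarrow> CARD('n) \<ge> 2"
    and \<Omega>: "open \<Omega>" "bounded \<Omega>"
    and sol: "viscosity_solution p \<Omega> \<nu> z q u"
    and c: "c = c_const p CARD('n)"
begin

text \<open>The paraboloid itself serves as test function: at an interior minimum of the difference
  it would touch \<open>u\<close> from below and force \<open>a / c \<ge> 1\<close>. Hence the
  minimum over the closure is attained on the frontier, where \<open>u\<close> is 0 and the
  paraboloid is at most 0.\<close>

lemma viscosity_solution_ge_paraboloid_strict:
  assumes "a < c" "\<And>y. y \<in> frontier \<Omega> \<Longrightarrow> paraboloid a b z y \<le> 0" "x \<in> closure \<Omega>"
  shows "paraboloid a b z x \<le> u x"
proof -
  have "compact (closure \<Omega>)" "continuous_on (closure \<Omega>) (\<lambda>x. u x - paraboloid a b z x)"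
    using \<Omega> sol by (auto simp: viscosity_solution_def compact_closure
        intro!: continuous_intros continuous_on_paraboloid)
  then have "\<exists>m\<in>closure \<Omega>. \<forall>y\<in>closure \<Omega>. u m - paraboloid a b z m \<le> u y - paraboloid a b z y"
    using assms(3) by (intro continuous_attains_inf) auto
  then obtain m where m: "m \<in> closure \<Omega>"
    "\<And>y. y \<in> closure \<Omega> \<Longrightarrow> u m - paraboloid a b z m \<le> u y - paraboloid a b z y"
    by auto
  have "m \<notin> \<Omega>"
  proof
    assume "m \<in> \<Omega>"
    moreover have "touches_below \<Omega> u m (paraboloid a b z)"
      unfolding touches_below_def eventually_at_filter
      by (rule always_eventually) (use m(2) in blast)
    ultimately have "- lower_laplacian p (paraboloid a b z) m \<ge> 1"
      using sol C2_on_paraboloid by (intro viscosity_solution_interior(2))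
    moreover have "c > 0"
      using c_const_pos[where 'n = 'n, OF p] c by simp
    ultimately show False
      using \<open>a < c\<close> by (simp add: laplacian_paraboloid(2)[OF p] c[symmetric] field_simps)
  qed
  then have "m \<in> frontier \<Omega>"
    using m(1) \<Omega> by (simp add: frontier_def interior_open)
  then have "u m = 0" "paraboloid a b z m \<le> 0"
    using sol assms(2) by (auto simp: viscosity_solution_def)
  with m(2)[OF assms(3)] show ?thesis by simp
qed

text \<open>Mirror image of the previous argument: an interior maximum of the difference would force
  \<open>a / c \<le> 1\<close>.\<close>

lemma viscosity_solution_le_paraboloid_strict:
  assumes "a > c" "\<And>y. y \<in> frontier \<Omega> \<Longrightarrow> paraboloid a b z y \<ge> 0" "x \<in> closure \<Omega>"
  shows "u x \<le> paraboloid a b z x"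
proof -
  have "compact (closure \<Omega>)" "continuous_on (closure \<Omega>) (\<lambda>x. u x - paraboloid a b z x)"
    using \<Omega> sol by (auto simp: viscosity_solution_def compact_closure
        intro!: continuous_intros continuous_on_paraboloid)
  then have "\<exists>m\<in>closure \<Omega>. \<forall>y\<in>closure \<Omega>. u y - paraboloid a b z y \<le> u m - paraboloid a b z m"
    using assms(3) by (intro continuous_attains_sup) auto
  then obtain m where m: "m \<in> closure \<Omega>"
    "\<And>y. y \<in> closure \<Omega> \<Longrightarrow> u y - paraboloid a b z y \<le> u m - paraboloid a b z m"
    by auto
  have "m \<notin> \<Omega>"
  proof
    assume "m \<in> \<Omega>"
    moreover have "touches_above \<Omega> u m (paraboloid a b z)"
      unfolding touches_above_def eventually_at_filter
      by (rule always_eventually) (use m(2) in blast)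
    ultimately have "- upper_laplacian p (paraboloid a b z) m \<le> 1"
      using sol C2_on_paraboloid by (intro viscosity_solution_interior(1))
    moreover have "c > 0"
      using c_const_pos[where 'n = 'n, OF p] c by simp
    ultimately show False
      using \<open>a > c\<close> by (simp add: laplacian_paraboloid(1)[OF p] c[symmetric] field_simps)
  qed
  then have "m \<in> frontier \<Omega>"
    using m(1) \<Omega> by (simp add: frontier_def interior_open)
  then have "u m = 0" "paraboloid a b z m \<ge> 0"
    using sol assms(2) by (auto simp: viscosity_solution_def)
  with m(2)[OF assms(3)] show ?thesis by simp
qed

text \<open>The strict comparison passes to the limit as \<open>a\<close> increases to
  \<open>c\<close>. The choice \<open>b = a / 2 * R\<^sup>2\<close> makes each paraboloid vanish on
  the sphere of radius \<open>R\<close>.\<close>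

lemma viscosity_solution_ge_paraboloid:
  assumes "R \<ge> 0" "\<And>y. y \<in> frontier \<Omega> \<Longrightarrow> R \<le> norm (y - z)" "x \<in> closure \<Omega>"
  shows "paraboloid c (c / 2 * R\<^sup>2) z x \<le> u x"
proof (rule tendsto_upperbound)
  show "((\<lambda>a. paraboloid a (a / 2 * R\<^sup>2) z x) \<longlongrightarrow> paraboloid c (c / 2 * R\<^sup>2) z x) (at_left c)"
    unfolding paraboloid_def by (intro tendsto_intros) auto
  \<comment> \<open>Restricting to positive \<open>a\<close> keeps the approximating paraboloids
    decreasing in the distance from \<open>z\<close>, hence nonpositive on the frontier.\<close>
  have "c > 0"
    using c_const_pos[where 'n = 'n, OF p] c by simp
  then have "\<forall>\<^sub>F a in at_left c. a \<in> {0<..<c}"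
    by (rule eventually_at_left_real)
  then show "\<forall>\<^sub>F a in at_left c. paraboloid a (a / 2 * R\<^sup>2) z x \<le> u x"
  proof eventually_elim
    case (elim a)
    show ?case
    proof (rule viscosity_solution_ge_paraboloid_strict)
      show "paraboloid a (a / 2 * R\<^sup>2) z y \<le> 0" if "y \<in> frontier \<Omega>" for y
        using elim assms(1) assms(2)[OF that] by (simp add: paraboloid_def power_mono)
    qed (use elim assms in auto)
  qed
qed simp

text \<open>Here \<open>a\<close> decreases to \<open>c\<close>, so that \<open>a\<close> is
  positive automatically and the paraboloids are nonnegative on the frontier.\<close>

lemma viscosity_solution_le_paraboloid:
  assumes "\<And>y. y \<in> frontier \<Omega> \<Longrightarrow> norm (y - z) \<le> R" "x \<in> closure \<Omega>"
  shows "u x \<le> paraboloid c (c / 2 * R\<^sup>2) z x"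
proof (rule tendsto_lowerbound)
  show "((\<lambda>a. paraboloid a (a / 2 * R\<^sup>2) z x) \<longlongrightarrow> paraboloid c (c / 2 * R\<^sup>2) z x) (at_right c)"
    unfolding paraboloid_def by (intro tendsto_intros) auto
  have "c > 0"
    using c_const_pos[where 'n = 'n, OF p] c by simp
  have "\<forall>\<^sub>F a in at_right c. a > c"
    by (simp add: eventually_at_filter)
  then show "\<forall>\<^sub>F a in at_right c. u x \<le> paraboloid a (a / 2 * R\<^sup>2) z x"
  proof eventually_elim
    case (elim a)
    show ?case
    proof (rule viscosity_solution_le_paraboloid_strict)
      show "paraboloid a (a / 2 * R\<^sup>2) z y \<ge> 0" if "y \<in> frontier \<Omega>" for y
        using elim \<open>c > 0\<close> assms(1)[OF that] by (simp add: paraboloid_def power_mono)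
    qed (use elim assms in auto)
  qed
qed simp

section \<open>Neumann condition at the extreme boundary points\<close>

text \<open>The paraboloid vanishing on the sphere through \<open>x0\<close> lies below
  \<open>u\<close> and equals it at \<open>x0\<close>, so it is admissible in the boundary
  condition; the left-hand side is minus its derivative along \<open>\<nu> x0\<close>.\<close>

lemma neumann_at_nearest_point:
  assumes "x0 \<in> frontier \<Omega>" "\<And>y. y \<in> frontier \<Omega> \<Longrightarrow> norm (x0 - z) \<le> norm (y - z)"
  shows "c * ((x0 - z) \<bullet> \<nu> x0) \<le> q (norm (x0 - z))"
proof -
  let ?w = "paraboloid c (c / 2 * (norm (x0 - z))\<^sup>2) z"
  have "u x0 - ?w x0 = 0"
    using sol assms(1) by (simp add: viscosity_solution_def paraboloid_def)
  moreover have "?w y \<le> u y" if "y \<in> closure \<Omega>" for y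
    using viscosity_solution_ge_paraboloid[OF norm_ge_zero assms(2) that] .
  ultimately have "touches_below \<Omega> u x0 ?w"
    unfolding touches_below_def eventually_at_filter by simp
  moreover have "\<exists>U. open U \<and> x0 \<in> U \<and> C2_on ?w U"
    using C2_on_paraboloid by blast
  ultimately have "- frechet_derivative ?w (at x0) (\<nu> x0) \<le> q (norm (x0 - z))"
    using sol assms(1) unfolding viscosity_solution_def by blast
  then show ?thesis by (simp add: frechet_derivative_paraboloid)
qed

text \<open>Now the paraboloid through \<open>x0\<close> lies above \<open>u\<close>, and the other
  half of the boundary condition applies.\<close>

lemma neumann_at_farthest_point:
  assumes "x0 \<in> frontier \<Omega>" "\<And>y. y \<in> frontier \<Omega> \<Longrightarrow> norm (y - z) \<le> norm (x0 - z)"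
  shows "q (norm (x0 - z)) \<le> c * ((x0 - z) \<bullet> \<nu> x0)"
proof -
  let ?w = "paraboloid c (c / 2 * (norm (x0 - z))\<^sup>2) z"
  have "u x0 - ?w x0 = 0"
    using sol assms(1) by (simp add: viscosity_solution_def paraboloid_def)
  moreover have "u y \<le> ?w y" if "y \<in> closure \<Omega>" for y
    using viscosity_solution_le_paraboloid[OF assms(2) that] .
  ultimately have "touches_above \<Omega> u x0 ?w"
    unfolding touches_above_def eventually_at_filter by simp
  moreover have "\<exists>U. open U \<and> x0 \<in> U \<and> C2_on ?w U"
    using C2_on_paraboloid by blast
  ultimately have "q (norm (x0 - z)) \<le> - frechet_derivative ?w (at x0) (\<nu> x0)"
    using sol assms(1) unfolding viscosity_solution_def by blast
  then show ?thesis by (simp add: frechet_derivative_paraboloid)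
qed

end

section \<open>The outer normal at a point touched by an interior ball\<close>

lemma inner_grad:
  assumes "\<phi> differentiable (at x)"
  shows "grad \<phi> x \<bullet> v = frechet_derivative \<phi> (at x) v"
proof -
  interpret linear "frechet_derivative \<phi> (at x)"
    using assms by (rule linear_frechet_derivative)
  have "frechet_derivative \<phi> (at x) v = frechet_derivative \<phi> (at x) (\<Sum>i\<in>UNIV. v $ i *\<^sub>R axis i 1)"
    using basis_expansion[of v] by (simp add: scalar_mult_eq_scaleR)
  also have "\<dots> = grad \<phi> x \<bullet> v"
    by (simp add: sum scale inner_vec_def grad_def mult.commute)
  finally show ?thesis ..
qed

text \<open>The derivative along \<open>v\<close> is also the right-hand limit of difference
  quotients, which are nonpositive here. The one-sided form fits directions that point into a ball
  from a point of its sphere.\<close>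

lemma has_derivative_le_0_at_right:
  fixes f :: "'a::real_normed_vector \<Rightarrow> real"
  assumes "(f has_derivative f') (at x)"
    and "\<forall>\<^sub>F t in at_right 0. f (x + t *\<^sub>R v) \<le> f x"
  shows "f' v \<le> 0"
proof (rule tendsto_upperbound)
  have "((\<lambda>t. f (x + t *\<^sub>R v)) has_derivative (\<lambda>t. f' (t *\<^sub>R v))) (at 0)"
    using assms(1)
    by (intro has_derivative_compose[of "\<lambda>t. x + t *\<^sub>R v" _ _ _ f])
      (auto intro!: derivative_eq_intros)
  moreover have "(\<lambda>t. f' (t *\<^sub>R v)) = (*) (f' v)"
    using has_derivative_linear[OF assms(1)] by (auto simp: linear_scale mult.commute)
  ultimately have "((\<lambda>t. f (x + t *\<^sub>R v)) has_field_derivative f' v) (at 0)"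
    by (simp add: has_field_derivative_def)
  then have "((\<lambda>t. (f (x + t *\<^sub>R v) - f x) / t) \<longlongrightarrow> f' v) (at 0)"
    by (simp add: DERIV_def)
  then show "((\<lambda>t. (f (x + t *\<^sub>R v) - f x) / t) \<longlongrightarrow> f' v) (at_right 0)"
    by (rule filterlim_mono) (auto simp: at_le)
  have "\<forall>\<^sub>F t::real in at_right 0. t > 0"
    by (simp add: eventually_at_filter)
  with assms(2) show "\<forall>\<^sub>F t in at_right 0. (f (x + t *\<^sub>R v) - f x) / t \<le> 0"
    by eventually_elim (simp add: divide_nonpos_pos)
qed simp

text \<open>Directions with negative inner product with \<open>x - z\<close> enter the ball, hence
  \<open>\<Omega>\<close>, where the defining function \<open>F\<close> of the chart is negative,
  while \<open>F x \<ge> 0\<close>. So the gradient of \<open>F\<close> is nonpositive on a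
  half-space, which makes it a nonnegative multiple of \<open>x - z\<close>; it is nonzero, and
  normalizing gives the claim for any chart.\<close>

lemma outer_unit_normal_interior_ball:
  assumes "outer_unit_normal \<Omega> x v" "ball z r \<subseteq> \<Omega>" "x \<in> frontier \<Omega>" "open \<Omega>"
    and "norm (x - z) = r" "r > 0"
  shows "v = (x - z) /\<^sub>R r"
proof -
  obtain U e g where U: "x \<in> U" "graph_chart \<Omega> U e g"
    and v: "v = sgn (grad (\<lambda>y. y \<bullet> e - g (perp e y)) x)"
    using assms(1) unfolding outer_unit_normal_def by blast
  define F where "F = (\<lambda>y. y \<bullet> e - g (perp e y))"
  define G where "G = grad F x"
  define d where "d = x - z"
  have "open U" and e: "norm e = 1" and dif: "(\<lambda>y. g (perp e y)) differentiable (at x)"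
    and eq: "\<Omega> \<inter> U = {y\<in>U. F y < 0}"
    using U unfolding graph_chart_def F_def by auto
  have difF: "F differentiable (at x)"
    unfolding F_def using dif by (intro derivative_intros) auto
  then have F': "(F has_derivative (\<lambda>h. G \<bullet> h)) (at x)"
    unfolding G_def inner_grad[OF difF] using difF by (simp add: frechet_derivative_works)
  have "x \<notin> \<Omega>" "x \<in> closure \<Omega>"
    using assms(3,4) by (auto simp: frontier_def interior_open)
  then have "F x \<ge> 0"
    using eq \<open>x \<in> U\<close> by fastforce
  have neg: "G \<bullet> h \<le> 0" if h: "h \<bullet> d < 0" for h
  proof -
    have nhds: "\<forall>\<^sub>F t in at_right (0::real). x + t *\<^sub>R h \<in> U"
    proof -
      have "((\<lambda>t. x + t *\<^sub>R h) \<longlongrightarrow> x + 0 *\<^sub>R h) (at_right 0)"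
        by (intro tendsto_intros)
      then show ?thesis
        using \<open>open U\<close> \<open>x \<in> U\<close> by (simp add: topological_tendstoD)
    qed
    \<comment> \<open>This is the increment of the squared distance from \<open>z\<close> along
      \<open>h\<close>, divided by \<open>t\<close>; its negativity for small \<open>t\<close> puts
      \<open>x + t *\<^sub>R h\<close> inside the ball.\<close>
    have "((\<lambda>t. 2 * (h \<bullet> d) + t * (h \<bullet> h)) \<longlongrightarrow> 2 * (h \<bullet> d) + 0 * (h \<bullet> h)) (at_right 0)"
      by (intro tendsto_intros)
    then have "\<forall>\<^sub>F t in at_right 0. 2 * (h \<bullet> d) + t * (h \<bullet> h) < 0"
      by (rule order_tendstoD(2)) (use h in simp)
    moreover have "\<forall>\<^sub>F t::real in at_right 0. t > 0"
      by (simp add: eventually_at_filter)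
    ultimately have "\<forall>\<^sub>F t in at_right 0. F (x + t *\<^sub>R h) \<le> F x"
      using nhds
    proof eventually_elim
      case (elim t)
      have "(norm (d + t *\<^sub>R h))\<^sup>2 = (norm d)\<^sup>2 + t * (2 * (h \<bullet> d) + t * (h \<bullet> h))"
        by (simp add: power2_norm_eq_inner algebra_simps inner_commute)
      also have "\<dots> < r\<^sup>2"
        using elim assms(5) by (simp add: d_def mult_pos_neg)
      finally have "norm (d + t *\<^sub>R h) < r"
        using assms(6) by (simp add: power_less_imp_less_base)
      then have "x + t *\<^sub>R h \<in> ball z r"
        by (simp add: d_def dist_norm norm_minus_commute[of z] algebra_simps)
      then have "F (x + t *\<^sub>R h) < 0"
        using assms(2) elim eq by blast
      with \<open>F x \<ge> 0\<close> show ?case by simp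
    qed
    then show ?thesis
      by (rule has_derivative_le_0_at_right[OF F'])
  qed
  have dd: "d \<bullet> d > 0"
    using assms(5,6) by (auto simp: d_def)
  \<comment> \<open>Extends the sign to the closed half-space by tilting \<open>h\<close> slightly
    towards \<open>- d\<close>.\<close>
  have neg': "G \<bullet> h \<le> 0" if "h \<bullet> d \<le> 0" for h
  proof (rule tendsto_upperbound)
    show "((\<lambda>t. G \<bullet> (h - t *\<^sub>R d)) \<longlongrightarrow> G \<bullet> h) (at_right 0)"
      by (auto intro!: tendsto_eq_intros)
    have "\<forall>\<^sub>F t::real in at_right 0. t > 0"
      by (simp add: eventually_at_filter)
    then show "\<forall>\<^sub>F t in at_right 0. G \<bullet> (h - t *\<^sub>R d) \<le> 0"
    proof eventually_elim
      case (elim t)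
      then have "t * (d \<bullet> d) > 0"
        using dd by simp
      with that show ?case
        by (intro neg) (simp add: inner_diff_left)
    qed
  qed simp
  \<comment> \<open>\<open>G - l *\<^sub>R d\<close> is the component of \<open>G\<close> orthogonal
    to \<open>d\<close>. It lies in the closed half-space, so its inner product with
    \<open>G\<close>, which is its own squared length, is nonpositive.\<close>
  define l where "l = (G \<bullet> d) / (d \<bullet> d)"
  have "(G - l *\<^sub>R d) \<bullet> d = 0"
    using dd by (simp add: l_def inner_diff_left)
  moreover have "G \<bullet> (G - l *\<^sub>R d) \<le> 0"
    using calculation by (intro neg') simp
  ultimately have "(G - l *\<^sub>R d) \<bullet> (G - l *\<^sub>R d) \<le> 0"
    by (simp add: inner_diff_left inner_commute)
  then have G: "G = l *\<^sub>R d"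
    by (metis inner_gt_zero_iff not_less right_minus_eq)
  have "l \<ge> 0"
    using neg[of "- d"] dd by (simp add: l_def)
  moreover have "G \<noteq> 0"
  proof
    assume "G = 0"
    \<comment> \<open>Moving along \<open>e\<close> leaves the graph term unchanged, so
      \<open>F\<close> has slope 1 in that direction.\<close>
    have "perp e (x + t *\<^sub>R e) = perp e x" for t
      using e by (simp add: perp_def inner_add_left norm_eq_1 scaleR_add_left)
    then have "(\<lambda>t. F (x + t *\<^sub>R e)) = (\<lambda>t. F x + t)"
      using e by (auto simp: F_def inner_add_left norm_eq_1)
    moreover have "((\<lambda>t. F (x + t *\<^sub>R e)) has_derivative (\<lambda>t. G \<bullet> (t *\<^sub>R e))) (at 0)"
      using F' by (intro has_derivative_compose[of "\<lambda>t. x + t *\<^sub>R e" _ _ _ F])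
        (auto intro!: derivative_eq_intros)
    ultimately have "((\<lambda>t. F x + t) has_derivative (\<lambda>t. 0)) (at 0)"
      using \<open>G = 0\<close> by simp
    moreover have "((\<lambda>t. F x + t) has_derivative (\<lambda>t. t)) (at 0)"
      by (auto intro!: derivative_eq_intros)
    ultimately have "(\<lambda>t::real. 0) = (\<lambda>t::real. t)"
      by (rule has_derivative_unique)
    then show False
      by (metis zero_neq_one)
  qed
  ultimately have "l > 0"
    using G by (cases "l = 0") auto
  have "v = sgn G"
    by (simp add: v G_def F_def)
  also have "\<dots> = d /\<^sub>R r"
    using \<open>l > 0\<close> assms(5) by (simp add: G sgn_div_norm d_def)
  finally show ?thesis by (simp add: d_def)
qed

text \<open>An upper bound is what the estimate at the farthest point requires, and
  \<open>sgn\<close> provides it whatever its argument.\<close>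

lemma norm_outer_unit_normal_le_1: "outer_unit_normal \<Omega> x v \<Longrightarrow> norm v \<le> 1"
  by (auto simp: outer_unit_normal_def norm_sgn)

section \<open>Inner and outer balls from distances to the frontier\<close>

text \<open>A ball is connected: meeting \<open>\<Omega>\<close> at its center without being
  contained in it, it would meet the frontier at distance less than \<open>R\<close>.\<close>

lemma ball_subset_if_frontier_far:
  fixes z :: "'a::real_normed_vector"
  assumes "z \<in> \<Omega>" "\<And>y. y \<in> frontier \<Omega> \<Longrightarrow> R \<le> norm (y - z)"
  shows "ball z R \<subseteq> \<Omega>"
proof (rule ccontr)
  assume ne: "\<not> ball z R \<subseteq> \<Omega>"
  then have "ball z R \<inter> \<Omega> \<noteq> {}"
    using assms(1) by (auto simp: disjoint_iff) (metis centre_in_ball dist_self order_le_less_trans zero_le_dist)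
  then have "ball z R \<inter> frontier \<Omega> \<noteq> {}"
    using ne by (intro connected_Int_frontier) auto
  then show False
    using assms(2) by (force simp: dist_norm norm_minus_commute)
qed

text \<open>The largest distance from \<open>z\<close> over the compact closure cannot be attained
  in the open set \<open>\<Omega>\<close>, so it is attained on the frontier. Openness also improves
  the closed ball to the open one.\<close>

lemma subset_ball_if_frontier_near:
  fixes z :: "'a::euclidean_space"
  assumes "open \<Omega>" "bounded \<Omega>" "\<And>y. y \<in> frontier \<Omega> \<Longrightarrow> norm (y - z) \<le> R"
  shows "\<Omega> \<subseteq> ball z R"
proof -
  have "\<Omega> \<subseteq> cball z R"
  proof (rule ccontr)
    assume "\<not> \<Omega> \<subseteq> cball z R"
    then obtain y where y: "y \<in> \<Omega>" "norm (y - z) > R"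
      by (auto simp: subset_iff dist_norm norm_minus_commute not_le)
    have "compact (closure \<Omega>)" "closure \<Omega> \<noteq> {}"
      using assms(2) y by (auto simp: compact_closure)
    then obtain m where m: "m \<in> closure \<Omega>" "\<And>y. y \<in> closure \<Omega> \<Longrightarrow> norm (y - z) \<le> norm (m - z)"
      using continuous_attains_sup[of "closure \<Omega>" "\<lambda>y. norm (y - z)"]
      by (force intro!: continuous_intros)
    show False
    proof (cases "m \<in> \<Omega>")
      case True
      then have "\<Omega> \<subseteq> cball z (norm (m - z))"
        using m(2) closure_subset[of \<Omega>] by (auto simp: dist_norm norm_minus_commute subset_iff)
      \<comment> \<open>An open subset of a closed ball lies in its interior, but \<open>m\<close>
        is on the bounding sphere.\<close>
      then have "\<Omega> \<subseteq> ball z (norm (m - z))"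
        using assms(1) interior_maximal interior_cball by metis
      with True show False by (auto simp: dist_norm norm_minus_commute)
    next
      case False
      then have "m \<in> frontier \<Omega>"
        using m assms(1) by (simp add: frontier_def interior_open)
      then show False
        using assms(3) m(2)[of y] y closure_subset by force
    qed
  qed
  then show ?thesis
    using assms(1) interior_maximal interior_cball by metis
qed

section \<open>Consequences for the overdetermined problem\<close>

theorem theorem1p1:
  fixes p :: ereal
    and \<Omega> :: "(real^'n) set"
    and \<nu> :: "real^'n \<Rightarrow> real^'n"
    and xbar :: "real^'n"
    and q :: "real \<Rightarrow> real"
    and R1 R2 c :: real
  assumes "1 \<le> p"
    and "p = 1 \<Longrightarrow> CARD('n) \<ge> 2"
    and "open \<Omega>" and "bounded \<Omega>"
    and "differentiable_boundary \<Omega>"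
    and "\<And>x. x \<in> frontier \<Omega> \<Longrightarrow> outer_unit_normal \<Omega> x (\<nu> x)"
    and "xbar \<in> \<Omega>"
    and "R1 = (INF x\<in>frontier \<Omega>. norm (x - xbar))"
    and "R2 = (SUP x\<in>frontier \<Omega>. norm (x - xbar))"
    and "c = c_const p (CARD('n))"
  shows
    "(\<forall>R\<in>{R1..R2}.
        q R - c * R = 0 \<and>
        (\<forall>r\<in>{R1..R2}. q r - c * r = 0 \<longrightarrow> r = R) \<and>
        (\<forall>r\<in>{R1..R2} - {R}. (q r - c * r) * (r - R) > 0) \<longrightarrow>
        ((\<exists>u. viscosity_solution p \<Omega> \<nu> xbar q u) \<longrightarrow> R1 = R \<and> R = R2 \<and> \<Omega> = ball xbar R) \<and>
        (R1 < R2 \<longrightarrow> \<not> (\<exists>u. viscosity_solution p \<Omega> \<nu> xbar q u)))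
     \<and> (strict_mono_on {R1..R2} (\<lambda>r. q r / r) \<longrightarrow>
        (\<exists>u. viscosity_solution p \<Omega> \<nu> xbar q u) \<longrightarrow> (\<exists>r>0. \<Omega> = ball xbar r))
     \<and> (continuous_on {R1..R2} q \<and> (\<forall>r\<in>{R1..R2}. q r - c * r \<noteq> 0) \<longrightarrow>
        \<not> (\<exists>u. viscosity_solution p \<Omega> \<nu> xbar q u))"
proof -
  have "compact (frontier \<Omega>)"
    using assms(4) by (simp add: compact_frontier_bounded)
  have "frontier \<Omega> \<noteq> {}"
    using assms(4,7) by (auto simp: frontier_eq_empty)
  have cont: "continuous_on (frontier \<Omega>) (\<lambda>x. norm (x - xbar))"
    by (intro continuous_intros)
  obtain x1 where x1: "x1 \<in> frontier \<Omega>"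
    "\<And>y. y \<in> frontier \<Omega> \<Longrightarrow> norm (x1 - xbar) \<le> norm (y - xbar)"
    using continuous_attains_inf[OF \<open>compact (frontier \<Omega>)\<close> \<open>frontier \<Omega> \<noteq> {}\<close> cont] by blast
  obtain x2 where x2: "x2 \<in> frontier \<Omega>"
    "\<And>y. y \<in> frontier \<Omega> \<Longrightarrow> norm (y - xbar) \<le> norm (x2 - xbar)"
    using continuous_attains_sup[OF \<open>compact (frontier \<Omega>)\<close> \<open>frontier \<Omega> \<noteq> {}\<close> cont] by blast
  have R1: "norm (x1 - xbar) = R1"
    unfolding assms(8) using x1 by (intro cInf_eq_minimum[symmetric]) auto
  have R2: "norm (x2 - xbar) = R2"
    unfolding assms(9) using x2 by (intro cSup_eq_maximum[symmetric]) auto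
  have "x1 \<noteq> xbar"
    using x1(1) assms(3,7) by (auto simp: frontier_def interior_open)
  then have "R1 > 0"
    using R1 by auto
  have "R1 \<le> R2"
    using x1(2)[OF x2(1)] R1 R2 by simp
  have "c > 0"
    using c_const_pos[where 'n = 'n, OF assms(1,2)] assms(10) by simp
  have inner_ball: "ball xbar R1 \<subseteq> \<Omega>"
    using assms(7) x1(2) by (intro ball_subset_if_frontier_far) (auto simp: R1)
  have outer_ball: "\<Omega> \<subseteq> ball xbar R2"
    using assms(3,4) x2(2) by (intro subset_ball_if_frontier_near) (auto simp: R2)
  \<comment> \<open>The ball of radius \<open>R1\<close> touches the frontier at \<open>x1\<close>
    from inside, so the normal there is radial.\<close>
  have \<nu>1: "(x1 - xbar) \<bullet> \<nu> x1 = R1"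
  proof -
    have "\<nu> x1 = (x1 - xbar) /\<^sub>R R1"
      by (rule outer_unit_normal_interior_ball[OF assms(6)[OF x1(1)] inner_ball x1(1) assms(3) R1])
        fact
    moreover have "(x1 - xbar) \<bullet> (x1 - xbar) = R1 * R1"
      by (simp flip: R1 add: power2_norm_eq_inner[symmetric] power2_eq_square)
    ultimately show ?thesis
      using \<open>R1 > 0\<close> by simp
  qed
  \<comment> \<open>At the farthest point Cauchy-Schwarz is enough: the normal enters only through
    an upper bound.\<close>
  have \<nu>2: "(x2 - xbar) \<bullet> \<nu> x2 \<le> R2"
  proof -
    have "(x2 - xbar) \<bullet> \<nu> x2 \<le> norm (x2 - xbar) * norm (\<nu> x2)"
      by (rule norm_cauchy_schwarz)
    also have "\<dots> \<le> norm (x2 - xbar)"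
      using norm_outer_unit_normal_le_1[OF assms(6)[OF x2(1)]] by (simp add: mult_left_le)
    finally show ?thesis by (simp add: R2)
  qed
  \<comment> \<open>All three claims use the solution only through these two endpoint
    inequalities.\<close>
  have key: "c * R1 \<le> q R1 \<and> q R2 \<le> c * R2" if "viscosity_solution p \<Omega> \<nu> xbar q u" for u
  proof
    show "c * R1 \<le> q R1"
      using neumann_at_nearest_point[OF assms(1-4) that assms(10) x1] by (simp add: R1 \<nu>1)
    have "q R2 \<le> c * ((x2 - xbar) \<bullet> \<nu> x2)"
      using neumann_at_farthest_point[OF assms(1-4) that assms(10) x2] by (simp add: R2)
    also have "\<dots> \<le> c * R2"
      using \<nu>2 \<open>c > 0\<close> by simp
    finally show "q R2 \<le> c * R2" .
  qed
  \<comment> \<open>If \<open>R1 < R\<close>, the sign condition gives \<open>q R1 < c * R1\<close>;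
    if \<open>R < R2\<close>, it gives \<open>q R2 > c * R2\<close>. Each contradicts
    \<open>key\<close>.\<close>
  have part1: "R1 = R \<and> R = R2"
    if "viscosity_solution p \<Omega> \<nu> xbar q u" "R \<in> {R1..R2}"
      and sign: "\<forall>r\<in>{R1..R2} - {R}. (q r - c * r) * (r - R) > 0" for u R
  proof
    show "R1 = R"
    proof (rule ccontr)
      assume "R1 \<noteq> R"
      then have "(q R1 - c * R1) * (R1 - R) > 0" "R1 < R"
        using sign that(2) by auto
      with key[OF that(1)] show False
        by (simp add: zero_less_mult_iff)
    qed
    show "R = R2"
    proof (rule ccontr)
      assume "R \<noteq> R2"
      then have "(q R2 - c * R2) * (R2 - R) > 0" "R < R2"
        using sign that(2) by auto
      with key[OF that(1)] show False
        by (simp add: zero_less_mult_iff)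
    qed
  qed
  \<comment> \<open>By \<open>key\<close>, \<open>q r / r\<close> is at least \<open>c\<close> at
    \<open>R1\<close> and at most \<open>c\<close> at \<open>R2\<close>, so it cannot increase
    strictly between distinct radii.\<close>
  have part2: "R1 = R2"
    if "viscosity_solution p \<Omega> \<nu> xbar q u" and mono: "strict_mono_on {R1..R2} (\<lambda>r. q r / r)" for u
  proof (rule ccontr)
    assume "R1 \<noteq> R2"
    with \<open>R1 \<le> R2\<close> have "q R1 / R1 < q R2 / R2"
      by (intro strict_mono_onD[OF mono]) auto
    moreover have "c \<le> q R1 / R1" "q R2 / R2 \<le> c"
      using key[OF that(1)] \<open>R1 > 0\<close> \<open>R1 \<le> R2\<close> by (simp_all add: field_simps)
    ultimately show False by simp
  qed
  \<comment> \<open>By \<open>key\<close>, \<open>q r - c * r\<close> is nonnegative at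
    \<open>R1\<close> and nonpositive at \<open>R2\<close>, so the intermediate value theorem yields
    a zero.\<close>
  have part3: "\<exists>r\<in>{R1..R2}. q r - c * r = 0"
    if "viscosity_solution p \<Omega> \<nu> xbar q u" "continuous_on {R1..R2} q" for u
  proof -
    have "\<exists>r\<ge>R1. r \<le> R2 \<and> q r - c * r = 0"
      using key[OF that(1)] that(2) \<open>R1 \<le> R2\<close>
      by (intro IVT2') (auto intro!: continuous_intros)
    then show ?thesis by auto
  qed
  have ball: "\<Omega> = ball xbar R1" if "R1 = R2"
    using inner_ball outer_ball that by auto
  show ?thesis
  proof (intro conjI ballI impI)
    fix R
    assume R: "R \<in> {R1..R2}" and H: "q R - c * R = 0 \<and>
        (\<forall>r\<in>{R1..R2}. q r - c * r = 0 \<longrightarrow> r = R) \<and>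
        (\<forall>r\<in>{R1..R2} - {R}. (q r - c * r) * (r - R) > 0)"
    note p1 = part1[OF _ R conjunct2[OF conjunct2[OF H]]]
    show "R1 = R" "R = R2" if "\<exists>u. viscosity_solution p \<Omega> \<nu> xbar q u"
      using that p1 by blast+
    then show "\<Omega> = ball xbar R" if "\<exists>u. viscosity_solution p \<Omega> \<nu> xbar q u"
      using that ball by blast
    show "\<nexists>u. viscosity_solution p \<Omega> \<nu> xbar q u" if "R1 < R2"
      using that p1 by force
  next
    assume "strict_mono_on {R1..R2} (\<lambda>r. q r / r)" "\<exists>u. viscosity_solution p \<Omega> \<nu> xbar q u"
    then show "\<exists>r>0. \<Omega> = ball xbar r"
      using part2 ball \<open>R1 > 0\<close> by blast
  next
    assume "continuous_on {R1..R2} q \<and> (\<forall>r\<in>{R1..R2}. q r - c * r \<noteq> 0)"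
    then show "\<nexists>u. viscosity_solution p \<Omega> \<nu> xbar q u"
      using part3 by blast
  qed
qed

end
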